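(* Let $f\colon\mathbb{D}\to\mathbb{D}$ be a non-elliptic map whose Koenigs domain is not the whole complex plane. For every $z\in\mathbb{D}$ and every $\epsilon>0$, there exists a constant $c=c(z,\epsilon)\in\mathbb{R}$ such that $$d_{\mathbb{D}}(z,f^n(z))\ge \frac{1}{4+\epsilon}\log n + c, \quad\text{for all }n\in\mathbb{N}.$$
   Context: $\mathbb{D}$ is the open unit disc and $\mathbb{N}=\{1,2,\dots\}$. $d_{\mathbb{D}}$ is the hyperbolic distance of $\mathbb{D}$ induced by the metric $\frac{|dz|}{1-|z|^2}$. A holomorphic map $f\colon\mathbb{D}\to\mathbb{D}$ is non-elliptic if it has no fixed point in $\mathbb{D}$; $f^n$ denotes its $n$-th iterate. A domain $\Omega\subseteq\mathbb{C}$ is starlike at infinity if $\Omega+t\subseteq\Omega$ for all $t\ge 0$; it is asymptotically starlike at infinity if $\Omega+1\subseteq\Omega$ and $\bigcup_{n=1}^\infty(\Omega-n)$ is starlike at infinity. A simply connected domain $U\subseteq\mathbb{D}$ is a fundamental domain of $f$ if $f$ is univalent on $U$, $f(U)\subseteq U$ and $\bigcup_{n\in\mathbb{N}}f^{-n}(U)=\mathbb{D}$. For a non-elliptic $f$, a Koenigs domain and a Koenigs function are a domain $\Omega$ asymptotically starlike at infinity and an onto holomorphic map $h\colon\mathbb{D}\to\Omega$ with $h\circ f=h+1$ and such that $h$ is univalent on some fundamental domain of $f$. Such a pair exists and is unique up to translation. *)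

theory Defs
  imports "HOL-Complex_Analysis.Complex_Analysis"
begin

abbreviation unit_disc :: "complex set" where
  "unit_disc \<equiv> ball 0 1"

text \<open>The infimum of the lengths of piecewise continuously differentiable paths in the disc with
  respect to the metric \<open>\<bar>dz\<bar> / (1 - \<bar>z\<bar>\<^sup>2)\<close>. A \<^const>\<open>valid_path\<close> may have an unbounded
  derivative near its finitely many exceptional points and so infinite length; using
  \<^const>\<open>has_integral\<close>, rather than \<^const>\<open>integral\<close> with its default value \<open>0\<close>, leaves such
  paths out.\<close>

definition hyp_dist :: "complex \<Rightarrow> complex \<Rightarrow> real" where
  "hyp_dist z w = Inf {L. \<exists>g. valid_path g \<and> path_image g \<subseteq> unit_disc \<and>
     pathstart g = z \<and> pathfinish g = w \<and>
     ((\<lambda>t. norm (vector_derivative g (at t within {0..1})) / (1 - (norm (g t))\<^sup>2))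
        has_integral L) {0..1}}"

definition domain :: "complex set \<Rightarrow> bool" where
  "domain S \<longleftrightarrow> open S \<and> connected S \<and> S \<noteq> {}"

definition univalent_on :: "(complex \<Rightarrow> complex) \<Rightarrow> complex set \<Rightarrow> bool" where
  "univalent_on f S \<longleftrightarrow> f holomorphic_on S \<and> inj_on f S"

definition non_elliptic :: "(complex \<Rightarrow> complex) \<Rightarrow> bool" where
  "non_elliptic f \<longleftrightarrow> f holomorphic_on unit_disc \<and> f ` unit_disc \<subseteq> unit_disc \<and>
     (\<forall>z\<in>unit_disc. f z \<noteq> z)"

definition starlike_at_infinity :: "complex set \<Rightarrow> bool" where
  "starlike_at_infinity S \<longleftrightarrow> domain S \<and>
     (\<forall>t::real. t \<ge> 0 \<longrightarrow> (\<lambda>w. w + complex_of_real t) ` S \<subseteq> S)"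

definition asymptotically_starlike_at_infinity :: "complex set \<Rightarrow> bool" where
  "asymptotically_starlike_at_infinity S \<longleftrightarrow> domain S \<and> (\<lambda>w. w + 1) ` S \<subseteq> S \<and>
     starlike_at_infinity (\<Union>n\<in>{1::nat..}. (\<lambda>w. w - of_nat n) ` S)"

definition fundamental_domain :: "(complex \<Rightarrow> complex) \<Rightarrow> complex set \<Rightarrow> bool" where
  "fundamental_domain f U \<longleftrightarrow> domain U \<and> simply_connected U \<and> U \<subseteq> unit_disc \<and>
     univalent_on f U \<and> f ` U \<subseteq> U \<and>
     (\<Union>n\<in>{1::nat..}. {z \<in> unit_disc. (f ^^ n) z \<in> U}) = unit_disc"

definition koenigs_pair ::
    "(complex \<Rightarrow> complex) \<Rightarrow> complex set \<Rightarrow> (complex \<Rightarrow> complex) \<Rightarrow> bool" where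
  "koenigs_pair f \<Omega> h \<longleftrightarrow> asymptotically_starlike_at_infinity \<Omega> \<and>
     h holomorphic_on unit_disc \<and> h ` unit_disc = \<Omega> \<and>
     (\<forall>z\<in>unit_disc. h (f z) = h z + 1) \<and>
     (\<exists>U. fundamental_domain f U \<and> univalent_on h U)"

end

theory Submission
  imports Defs
begin

text \<open>Pick a point \<open>p\<close> outside the Koenigs domain \<open>\<Omega>\<close>. Since \<open>\<Omega> + 1 \<subseteq> \<Omega>\<close>, none of the points
  \<open>p - k\<close> with \<open>k\<close> a natural number lies in \<open>\<Omega>\<close>, so the function \<open>g = p - h\<close> omits every natural
  number, and it satisfies \<open>g \<circ> f\<^sup>n = g - n\<close>. Seen from far away, the natural numbers look like
  the half-line \<open>[0, \<infinity>)\<close>. A holomorphic function on the disc that omits this half-line satisfies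
  \<open>\<bar>g'(0)\<bar> \<le> 4 \<bar>g(0)\<bar>\<close> (\<open>deriv_bound_omits_half_line\<close>); this is the source of the \<open>4\<close> in \<open>1 / (4 + \<epsilon>)\<close>.

  For functions that only omit the natural numbers, a compactness argument gives almost the same
  estimate: for each \<open>K > 4\<close> there is a \<open>C\<close> with \<open>\<bar>g'(0)\<bar> \<le> K (\<bar>g(0)\<bar> + C)\<close>
  (\<open>deriv_bound_omits_nats\<close>). Otherwise rescaled counterexamples would form a normal family, by the
  theorems of Schottky and Montel, and by Hurwitz's theorem a limit of them would omit
  the whole half-line and contradict the first estimate. It is the additive constant \<open>C\<close> that lets
  one argument treat both bounded and unbounded values \<open>g(0)\<close>.

  Moving any point of the disc to the centre by an automorphism turns this into a bound for
  \<open>(1 - \<bar>z\<bar>\<^sup>2) \<bar>g'(z)\<bar>\<close>, which says that \<open>ln (\<bar>g\<bar> + C)\<close> grows along a path by at most \<open>K\<close> times the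
  hyperbolic length (\<open>ln_growth_le_hyp_dist\<close>). Between \<open>z\<close> and \<open>f\<^sup>n(z)\<close> it grows by
  \<open>ln n + O(1)\<close>, because \<open>g\<close> is translated by \<open>-n\<close>. With \<open>K = 4 + \<epsilon>\<close> the claim follows.\<close>

section \<open>Holomorphic functions omitting a half-line\<close>

text \<open>The square root maps the slit plane onto a half-plane, where the Schwarz lemma bounds the
  derivative of \<open>s = \<surd>(-g)\<close> by \<open>2 Re (s 0) \<le> 2 \<bar>s 0\<bar>\<close>; then \<open>g' = -2 s s'\<close> contributes the other
  factor \<open>2\<close>.\<close>

lemma deriv_bound_omits_half_line:
  assumes hol: "g holomorphic_on ball 0 1"
    and omits: "\<And>z x. z \<in> ball 0 1 \<Longrightarrow> 0 \<le> x \<Longrightarrow> g z \<noteq> complex_of_real x"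
  shows "norm (deriv g 0) \<le> 4 * norm (g 0)"
proof -
  define s where "s z = csqrt (- g z)" for z
  have slit: "- g z \<notin> \<real>\<^sub>\<le>\<^sub>0" if "z \<in> ball 0 1" for z
  proof
    assume "- g z \<in> \<real>\<^sub>\<le>\<^sub>0"
    then obtain r where "r \<le> 0" "- g z = complex_of_real r"
      by (auto simp: nonpos_Reals_def)
    then have "g z = complex_of_real (- r)" "0 \<le> - r"
      by (auto simp: minus_equation_iff)
    with omits[OF that] show False by blast
  qed
  have hols: "s holomorphic_on ball 0 1"
    unfolding s_def using slit by (intro holomorphic_intros hol) auto
  have sq: "g z = - (s z)\<^sup>2" for z
    by (simp add: s_def)
  have Re_s: "Re (s z) > 0" if "z \<in> ball 0 1" for z
  proof -
    have "Re (s z) \<noteq> 0"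
      using csqrt_principal[of "- g z"] omits[OF that, of "(Im (s z))\<^sup>2"]
      by (auto simp: sq complex_eq_iff power2_eq_square)
    then show ?thesis
      using csqrt_principal[of "- g z"] by (auto simp: s_def)
  qed
  define a where "a = s 0"
  have a: "Re a > 0" unfolding a_def by (rule Re_s) simp
  \<comment> \<open>The Cayley transform sending the right half-plane to the disc and \<open>s 0\<close> to the centre.\<close>
  define \<phi> where "\<phi> z = (s z - a) / (s z + cnj a)" for z
  have den: "s z + cnj a \<noteq> 0" if "z \<in> ball 0 1" for z
    using Re_s[OF that] a by (auto simp: complex_eq_iff)
  have hol\<phi>: "\<phi> holomorphic_on ball 0 1"
    unfolding \<phi>_def using den by (intro holomorphic_intros hols) auto
  have \<phi>0: "\<phi> 0 = 0" by (simp add: \<phi>_def a_def)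
  have \<phi>1: "norm (\<phi> z) < 1" if "norm z < 1" for z
  proof -
    have z: "z \<in> ball 0 1" using that by simp
    have "(norm (s z - a))\<^sup>2 < (norm (s z + cnj a))\<^sup>2"
      using mult_pos_pos[OF Re_s[OF z] a]
      by (simp add: cmod_power2) (simp add: power2_eq_square algebra_simps)
    then have "norm (s z - a) < norm (s z + cnj a)"
      by (rule power2_less_imp_less) simp
    then show ?thesis
      using den[OF z] by (simp add: \<phi>_def norm_divide)
  qed
  have d\<phi>: "norm (deriv \<phi> 0) \<le> 1"
    by (rule Schwarz_Lemma(2)[OF hol\<phi> \<phi>0 \<phi>1, of 0]) auto
  define s' where "s' = deriv s 0"
  have s': "(s has_field_derivative s') (at 0)"
    unfolding s'_def by (rule holomorphic_derivI[OF hols]) auto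
  have ne: "a + cnj a \<noteq> 0" using den[of 0] by (simp add: a_def)
  have "((\<lambda>z. s z - a) has_field_derivative s') (at 0)"
    "((\<lambda>z. s z + cnj a) has_field_derivative s') (at 0)"
    using s' by (auto intro!: derivative_eq_intros)
  from DERIV_divide[OF this] ne
  have "(\<phi> has_field_derivative s' / (a + cnj a)) (at 0)"
    unfolding \<phi>_def[abs_def] by (simp flip: a_def)
  then have "deriv \<phi> 0 = s' / (2 * of_real (Re a))"
    by (simp add: DERIV_imp_deriv complex_add_cnj)
  with d\<phi> a have "norm s' \<le> 2 * Re a"
    by (simp add: norm_divide norm_mult)
  also have "\<dots> \<le> 2 * norm a" using complex_Re_le_cmod[of a] by simp
  finally have s'a: "norm s' \<le> 2 * norm a" .
  have "((\<lambda>z. - (s z)\<^sup>2) has_field_derivative - (2 * a * s')) (at 0)"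
    using s' by (auto intro!: derivative_eq_intros simp: a_def)
  then have "deriv g 0 = - (2 * a * s')"
    using DERIV_imp_deriv by (simp flip: sq)
  then have "norm (deriv g 0) = 2 * norm a * norm s'"
    by (simp add: norm_mult)
  also have "\<dots> \<le> 2 * norm a * (2 * norm a)"
    by (intro mult_left_mono s'a) auto
  also have "\<dots> = 4 * norm (g 0)"
    by (simp add: sq a_def norm_mult power2_eq_square)
  finally show ?thesis .
qed

section \<open>Holomorphic functions omitting the natural numbers\<close>

text \<open>Schottky's theorem concerns functions on the closed disc. To cover \<open>K\<close>, which lies in some disc
  of radius \<open>\<rho> < 1\<close>, it is applied to \<open>w \<mapsto> g (t w)\<close> with \<open>t = \<surd>\<rho>\<close>, so that both the dilation factor and
  the radius at which Schottky's bound is used are \<open>t < 1\<close>.\<close>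

lemma omits_0_1_locally_bounded:
  assumes "compact K" "K \<subseteq> ball (0::complex) 1"
  shows "\<exists>B. \<forall>g z. g holomorphic_on ball 0 1 \<longrightarrow> norm (g 0) \<le> r \<longrightarrow>
    (\<forall>w\<in>ball 0 1. g w \<noteq> 0 \<and> g w \<noteq> 1) \<longrightarrow> z \<in> K \<longrightarrow> norm (g z) \<le> B"
proof -
  obtain \<rho> where \<rho>: "0 < \<rho>" "\<rho> < 1" "K \<subseteq> cball 0 \<rho>"
  proof (cases "K = {}")
    case True
    then show ?thesis using that[of "1/2"] by auto
  next
    case False
    obtain x where x: "x \<in> K" "\<And>y. y \<in> K \<Longrightarrow> norm y \<le> norm x"
      using continuous_attains_sup[OF assms(1) False, of norm] continuous_on_norm_id by blast
    have "norm x < 1" using x assms by auto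
    then show ?thesis using x that[of "(1 + norm x) / 2"]
      by (force simp: field_simps add_pos_nonneg)
  qed
  define t where "t = sqrt \<rho>"
  have t: "0 < t" "t < 1" "t * t = \<rho>" using \<rho> by (auto simp: t_def)
  show ?thesis
  proof (intro exI allI impI)
    fix g z
    assume hol: "g holomorphic_on ball 0 1" and r: "norm (g 0) \<le> r"
      and om: "\<forall>w\<in>ball 0 1. g w \<noteq> 0 \<and> g w \<noteq> 1" and z: "z \<in> K"
    have sub: "complex_of_real t * w \<in> ball 0 1" if "w \<in> cball 0 1" for w
    proof -
      have "t * norm w \<le> t * 1" using that t by (intro mult_left_mono) auto
      then have "t * norm w < 1" using t by linarith
      then show ?thesis using t by (simp add: norm_mult)
    qed
    have "norm ((\<lambda>w. g (of_real t * w)) (z / of_real t))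
      \<le> exp (pi * exp (pi * (2 + 2 * r + 12 * t / (1 - t))))"
    proof (rule Schottky[where f = "\<lambda>w. g (of_real t * w)"])
      show "(\<lambda>w. g (of_real t * w)) holomorphic_on cball 0 1"
        using sub by (intro holomorphic_on_compose_gen[OF _ hol, unfolded o_def] holomorphic_intros) auto
      show "norm (z / of_real t) \<le> t"
        using z \<rho> t by (auto simp: norm_divide field_simps)
      show "\<not> (g (of_real t * w) = 0 \<or> g (of_real t * w) = 1)" if "w \<in> cball 0 1" for w
        using om sub[OF that] by blast
    qed (use r t in auto)
    then show "norm (g z) \<le> exp (pi * exp (pi * (2 + 2 * r + 12 * t / (1 - t))))"
      using t by simp
  qed
qed

text \<open>Each \<open>x \<ge> 0\<close> is a limit of points of the grids \<open>{k / N n}\<close>, whose meshes shrink to \<open>0\<close>. Subtracting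
  these points from \<open>G n\<close> gives zero-free functions converging to \<open>g - x\<close>, to which
  Hurwitz's theorem applies.\<close>

lemma limit_omits_half_line:
  fixes G :: "nat \<Rightarrow> complex \<Rightarrow> complex" and N :: "nat \<Rightarrow> nat"
  assumes S: "open S" "connected S"
    and hol: "\<And>n. G n holomorphic_on S" "g holomorphic_on S"
    and lim: "\<And>K. compact K \<Longrightarrow> K \<subseteq> S \<Longrightarrow> uniform_limit K G g sequentially"
    and nonconst: "\<not> g constant_on S"
    and N: "filterlim N at_top sequentially"
    and omits: "\<And>n k z. z \<in> S \<Longrightarrow> G n z \<noteq> of_nat k / of_nat (N n)"
    and z: "z \<in> S" and x: "0 \<le> x"
  shows "g z \<noteq> complex_of_real x"
proof -
  define q where "q n = real (nat \<lfloor>x * real (N n)\<rfloor>) / real (N n)" for n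
  have Nr: "filterlim (\<lambda>n. real (N n)) at_top sequentially"
    using filterlim_compose[OF filterlim_real_sequentially N] .
  have "q \<longlonglongrightarrow> x"
  proof (rule Lim_null_comparison[where g = "\<lambda>n. 1 / real (N n)", THEN LIM_zero_cancel])
    show "(\<lambda>n. 1 / real (N n)) \<longlonglongrightarrow> 0"
      using tendsto_inverse_0_at_top[OF Nr] by (simp add: inverse_eq_divide)
    have "\<forall>\<^sub>F n in sequentially. N n \<ge> 1"
      using N by (auto simp: filterlim_at_top)
    then show "\<forall>\<^sub>F n in sequentially. norm (q n - x) \<le> 1 / real (N n)"
    proof eventually_elim
      case (elim n)
      have "\<bar>real (nat \<lfloor>x * real (N n)\<rfloor>) - x * real (N n)\<bar> \<le> 1"
        using x by (simp add: of_nat_nat) linarith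
      moreover have "q n - x = (real (nat \<lfloor>x * real (N n)\<rfloor>) - x * real (N n)) / real (N n)"
        using elim by (simp add: q_def field_simps)
      ultimately show ?case
        using elim by (simp add: divide_right_mono)
    qed
  qed
  then have qlim: "(\<lambda>n. complex_of_real (q n)) \<longlonglongrightarrow> of_real x"
    by (rule tendsto_of_real)
  have "g z - of_real x \<noteq> 0"
  proof (rule Hurwitz_no_zeros[OF S, where \<F> = "\<lambda>n w. G n w - of_real (q n)"
      and g = "\<lambda>w. g w - of_real x"])
    show "(\<lambda>w. G n w - of_real (q n)) holomorphic_on S" for n
      by (intro holomorphic_intros hol)
    show "(\<lambda>w. g w - of_real x) holomorphic_on S"
      by (intro holomorphic_intros hol)
    show "uniform_limit K (\<lambda>n w. G n w - of_real (q n)) (\<lambda>w. g w - of_real x) sequentially"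
      if "compact K" "K \<subseteq> S" for K
    proof (rule uniform_limit_minus[OF lim[OF that]])
      show "uniform_limit K (\<lambda>n w. complex_of_real (q n)) (\<lambda>w. of_real x) sequentially"
        using qlim by (auto simp: uniform_limit_iff tendsto_iff elim!: eventually_mono)
    qed
    show "\<not> (\<lambda>w. g w - of_real x) constant_on S"
    proof
      assume "(\<lambda>w. g w - complex_of_real x) constant_on S"
      then obtain c where "\<And>w. w \<in> S \<Longrightarrow> g w - of_real x = c"
        unfolding constant_on_def by blast
      then have "\<And>w. w \<in> S \<Longrightarrow> g w = c + of_real x" by (metis diff_add_cancel)
      with nonconst show False unfolding constant_on_def by blast
    qed
    show "G n w - of_real (q n) \<noteq> 0" if "w \<in> S" for n w
      using omits[OF that, of n "nat \<lfloor>x * real (N n)\<rfloor>"] by (simp add: q_def)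
  qed (rule z)
  then show ?thesis by simp
qed

text \<open>If no \<open>C\<close> works, take for each \<open>j\<close> a function \<open>g j\<close> that violates the bound with \<open>C = j + 2\<close>, and
  divide it by an integer \<open>N j\<close> of size about \<open>\<bar>g j 0\<bar> + j\<close>. The quotients have values at most \<open>1\<close> and
  derivatives at least \<open>K\<close> at the centre, and they omit finer and finer grids on the half-line.\<close>

lemma deriv_bound_omits_nats:
  assumes "K > 4"
  obtains C where "C > 0"
    "\<And>g. g holomorphic_on ball 0 1 \<Longrightarrow> (\<And>z k. z \<in> ball 0 1 \<Longrightarrow> g z \<noteq> of_nat k) \<Longrightarrow>
       norm (deriv g 0) \<le> K * (norm (g 0) + C)"
proof (rule ccontr)
  assume not: "\<not> thesis"
  have "\<exists>g. g holomorphic_on ball 0 1 \<and> (\<forall>z\<in>ball 0 1. \<forall>k. g z \<noteq> of_nat k) \<and>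
      norm (deriv g 0) > K * (norm (g 0) + (real j + 2))" for j :: nat
    using that[of "real j + 2"] not by (force simp: not_le)
  then obtain g where hol: "\<And>j. g j holomorphic_on ball 0 1"
    and omits: "\<And>j z k. z \<in> ball 0 1 \<Longrightarrow> g j z \<noteq> of_nat k"
    and big: "\<And>j. norm (deriv (g j) 0) > K * (norm (g j 0) + (real j + 2))"
    by metis
  \<comment> \<open>Scaling by an integer makes every \<open>G j\<close> omit \<open>0 = 0 / N j\<close> and \<open>1 = N j / N j\<close>, as
    Schottky's theorem requires. The summand \<open>j + 1\<close> forces \<open>N j \<longlongrightarrow> \<infinity>\<close> even when the values \<open>g j 0\<close>
    stay bounded, and rounding up costs at most \<open>1\<close>, whence \<open>j + 2\<close> above.\<close>
  define N where "N j = nat \<lceil>norm (g j 0)\<rceil> + (j + 1)" for j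
  define G where "G j z = g j z / of_nat (N j)" for j z
  have Npos: "0 < N j" for j by (simp add: N_def)
  have N1: "norm (g j 0) \<le> real (N j)" for j unfolding N_def by linarith
  have N2: "real (N j) \<le> norm (g j 0) + (real j + 2)" for j unfolding N_def by (simp add: of_nat_nat) linarith
  have holG: "G j holomorphic_on ball 0 1" for j
    unfolding G_def using Npos[of j] by (intro holomorphic_intros hol) auto
  have G0: "norm (G j 0) \<le> 1" for j
    using N1[of j] Npos[of j] by (simp add: G_def norm_divide)
  have omitsG: "G j z \<noteq> of_nat k / of_nat (N j)" if "z \<in> ball 0 1" for j z k
    using omits[OF that, of j k] Npos[of j] by (simp add: G_def)
  have dG: "norm (deriv (G j) 0) \<ge> K" for j
  proof -
    have "g j field_differentiable (at 0)"
      using hol[of j] by (rule holomorphic_on_imp_differentiable_at) auto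
    then have "deriv (G j) 0 = deriv (g j) 0 / of_nat (N j)"
      unfolding G_def using deriv_cdivide_right by blast
    moreover have "K * real (N j) \<le> norm (deriv (g j) 0)"
      using mult_left_mono[OF N2[of j], of K] big[of j] assms by linarith
    ultimately show ?thesis
      using Npos[of j] by (simp add: norm_divide pos_le_divide_eq)
  qed
  define \<H> where "\<H> = {g. g holomorphic_on ball (0::complex) 1 \<and> norm (g 0) \<le> 1 \<and>
    (\<forall>w\<in>ball 0 1. g w \<noteq> 0 \<and> g w \<noteq> 1)}"
  have in\<H>: "range G \<subseteq> \<H>"
  proof -
    have "G j w \<noteq> 0 \<and> G j w \<noteq> 1" if "w \<in> ball 0 1" for j w
      using omitsG[OF that, of j 0] omitsG[OF that, of j "N j"] Npos[of j] by auto
    then show ?thesis using holG G0 by (auto simp: \<H>_def)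
  qed
  obtain L r where L: "L holomorphic_on ball 0 1" and r: "strict_mono (r :: nat \<Rightarrow> nat)"
    and ptw: "\<And>x. x \<in> ball 0 1 \<Longrightarrow> (\<lambda>n. G (r n) x) \<longlonglongrightarrow> L x"
    and unif: "\<And>K. compact K \<Longrightarrow> K \<subseteq> ball 0 1 \<Longrightarrow> uniform_limit K (G \<circ> r) L sequentially"
  proof (rule Montel[of "ball 0 1" \<H> G])
    show "\<exists>B. \<forall>h\<in>\<H>. \<forall>z\<in>K. norm (h z) \<le> B" if "compact K" "K \<subseteq> ball 0 1" for K
      using omits_0_1_locally_bounded[OF that, of 1] unfolding \<H>_def by fast
  qed (use in\<H> in \<open>auto simp: \<H>_def\<close>)
  have "(\<lambda>n. deriv ((G \<circ> r) n) 0) \<longlonglongrightarrow> deriv L 0"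
  proof (rule deriv_complex_uniform_limit)
    show "uniform_limit (ball 0 (1/2)) (G \<circ> r) L sequentially"
      by (rule uniform_limit_on_subset[OF unif[of "cball 0 (1/2)"]]) auto
    show "\<forall>\<^sub>F n in sequentially. (G \<circ> r) n holomorphic_on ball 0 (1/2)"
      using holG by (auto intro!: always_eventually holomorphic_on_subset[OF holG])
  qed auto
  then have "(\<lambda>n. norm (deriv ((G \<circ> r) n) 0)) \<longlonglongrightarrow> norm (deriv L 0)"
    by (rule tendsto_norm)
  then have dL: "K \<le> norm (deriv L 0)"
    by (rule LIMSEQ_le_const) (use dG in auto)
  have L0: "norm (L 0) \<le> 1"
    by (rule LIMSEQ_le_const2[OF tendsto_norm[OF ptw]]) (use G0 in auto)
  have nonconst: "\<not> L constant_on ball 0 1"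
  proof
    assume "L constant_on ball 0 1"
    then obtain c where c: "\<And>w. w \<in> ball 0 1 \<Longrightarrow> L w = c"
      unfolding constant_on_def by blast
    have "(L has_field_derivative 0) (at 0)"
      by (rule has_field_derivative_transform_within_open[of "\<lambda>_. c" _ _ "ball 0 1"])
        (use c in auto)
    with dL assms show False by (simp add: DERIV_imp_deriv)
  qed
  have Nr: "filterlim (\<lambda>n. N (r n)) at_top sequentially"
  proof (rule filterlim_at_top_mono[OF filterlim_subseq[OF r]])
    show "\<forall>\<^sub>F n in sequentially. r n \<le> N (r n)" by (simp add: N_def)
  qed
  have "norm (deriv L 0) \<le> 4 * norm (L 0)"
  proof (rule deriv_bound_omits_half_line[OF L])
    show "L z \<noteq> complex_of_real x" if "z \<in> ball 0 1" "0 \<le> x" for z x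
      by (rule limit_omits_half_line[OF _ _ _ L unif nonconst Nr])
        (use holG omitsG that in auto)
  qed
  with dL L0 assms show False by linarith
qed

text \<open>The hypothesis only concerns the set of values of \<open>g\<close>, so it is inherited by \<open>g \<circ> M\<close>
  for any automorphism \<open>M\<close> of the disc; the factor \<open>1 - \<bar>z\<bar>\<^sup>2\<close> is \<open>M'(0)\<close> when \<open>M 0 = z\<close>. Consequently \<open>C\<close>
  depends on \<open>K\<close> alone.\<close>

lemma conformal_deriv_bound_omits_nats:
  assumes "K > 4"
  obtains C where "C > 0"
    "\<And>g z. g holomorphic_on ball 0 1 \<Longrightarrow> (\<And>z k. z \<in> ball 0 1 \<Longrightarrow> g z \<noteq> of_nat k) \<Longrightarrow>
       z \<in> ball 0 1 \<Longrightarrow> (1 - (norm z)\<^sup>2) * norm (deriv g z) \<le> K * (norm (g z) + C)"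
proof -
  obtain C where C: "C > 0"
    and bd: "\<And>g. g holomorphic_on ball 0 1 \<Longrightarrow> (\<And>z k. z \<in> ball 0 1 \<Longrightarrow> g z \<noteq> of_nat k) \<Longrightarrow>
       norm (deriv g 0) \<le> K * (norm (g 0) + C)"
    using deriv_bound_omits_nats[OF assms] by metis
  show thesis
  proof (rule that[OF C])
    fix g z
    assume hol: "g holomorphic_on ball 0 1"
      and omits: "\<And>z k. z \<in> ball 0 1 \<Longrightarrow> g z \<noteq> of_nat k" and z: "z \<in> ball (0::complex) 1"
    define M where "M = Moebius_function 0 (- z)"
    have holM: "M holomorphic_on ball 0 1"
      unfolding M_def using z by (intro Moebius_function_holomorphic) auto
    have Mball: "M w \<in> ball 0 1" if "w \<in> ball 0 1" for w
      using Moebius_function_norm_lt_1[of "- z" w 0] that z by (simp add: M_def)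
    have M0: "M 0 = z" by (simp add: M_def Moebius_function_of_zero)
    have dM: "(M has_field_derivative of_real (1 - (norm z)\<^sup>2)) (at 0)"
      unfolding M_def Moebius_function_simple[abs_def]
      by (rule derivative_eq_intros refl | simp)+
         (simp add: complex_norm_square[symmetric] mult.commute)
    have dg: "(g has_field_derivative deriv g z) (at (M 0))"
      unfolding M0 using hol z by (intro holomorphic_derivI) auto
    have "deriv (g \<circ> M) 0 = deriv g z * of_real (1 - (norm z)\<^sup>2)"
      by (rule DERIV_imp_deriv) (rule DERIV_chain[OF dg dM])
    moreover have "norm (deriv (g \<circ> M) 0) \<le> K * (norm ((g \<circ> M) 0) + C)"
    proof (rule bd)
      show "g \<circ> M holomorphic_on ball 0 1"
        using Mball by (intro holomorphic_on_compose_gen[OF holM hol]) auto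
    qed (use omits Mball in auto)
    moreover have "(norm z)\<^sup>2 < 1" using z by (simp add: power_less_one_iff abs_square_less_1)
    ultimately show "(1 - (norm z)\<^sup>2) * norm (deriv g z) \<le> K * (norm (g z) + C)"
      by (simp add: norm_mult M0 mult.commute del: of_real_diff)
  qed
qed

section \<open>Lengths of paths\<close>

text \<open>An infimum of reals is bounded below by a lower bound of the set only if the set is
  nonempty. The segment from \<open>z\<close> to \<open>w\<close> is a path of finite length in the disc.\<close>

lemma hyp_dist_greatest:
  assumes zw: "z \<in> unit_disc" "w \<in> unit_disc"
    and bound: "\<And>\<gamma> L. valid_path \<gamma> \<Longrightarrow> path_image \<gamma> \<subseteq> unit_disc \<Longrightarrow>
      pathstart \<gamma> = z \<Longrightarrow> pathfinish \<gamma> = w \<Longrightarrow>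
      ((\<lambda>t. norm (vector_derivative \<gamma> (at t within {0..1})) / (1 - (norm (\<gamma> t))\<^sup>2))
        has_integral L) {0..1} \<Longrightarrow> B \<le> L"
  shows "B \<le> hyp_dist z w"
  unfolding hyp_dist_def
proof (rule cInf_greatest)
  let ?s = "linepath z w"
  have img: "path_image ?s \<subseteq> unit_disc"
    using zw by (simp add: closed_segment_subset)
  have "(norm (?s t))\<^sup>2 < 1" if "t \<in> {0..1}" for t
    using img that by (force simp: path_image_def abs_square_less_1)
  then have "continuous_on {0..1} (\<lambda>t. norm (w - z) / (1 - (norm (?s t))\<^sup>2))"
    by (intro continuous_intros) force
  then have "(\<lambda>t. norm (w - z) / (1 - (norm (?s t))\<^sup>2)) integrable_on {0..1}"
    by (rule integrable_continuous_real)
  then obtain L where "((\<lambda>t. norm (w - z) / (1 - (norm (?s t))\<^sup>2)) has_integral L) {0..1}"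
    by blast
  then have "((\<lambda>t. norm (vector_derivative ?s (at t within {0..1})) / (1 - (norm (?s t))\<^sup>2))
      has_integral L) {0..1}"
    by (rule has_integral_eq[rotated]) (simp add: vector_derivative_linepath_within)
  then show "{L. \<exists>g. valid_path g \<and> path_image g \<subseteq> unit_disc \<and>
     pathstart g = z \<and> pathfinish g = w \<and>
     ((\<lambda>t. norm (vector_derivative g (at t within {0..1})) / (1 - (norm (g t))\<^sup>2))
        has_integral L) {0..1}} \<noteq> {}"
    using img by (blast intro: valid_path_linepath pathstart_linepath pathfinish_linepath)
qed (use bound in blast)

text \<open>Along a path \<open>\<gamma>\<close> the derivative of \<open>ln (\<bar>g\<bar> + C)\<close> is at most
  \<open>\<bar>g'\<bar> \<bar>\<gamma>'\<bar> / (\<bar>g\<bar> + C) \<le> K \<bar>\<gamma>'\<bar> / (1 - \<bar>\<gamma>\<bar>\<^sup>2)\<close>. The condition \<open>g \<noteq> 0\<close> makes \<open>\<bar>g\<bar>\<close> differentiable.\<close>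

lemma ln_growth_le_hyp_dist:
  assumes hol: "g holomorphic_on unit_disc"
    and nz: "\<And>z. z \<in> unit_disc \<Longrightarrow> g z \<noteq> 0"
    and C: "C > 0" and K: "K > 0"
    and bd: "\<And>z. z \<in> unit_disc \<Longrightarrow> (1 - (norm z)\<^sup>2) * norm (deriv g z) \<le> K * (norm (g z) + C)"
    and zw: "z \<in> unit_disc" "w \<in> unit_disc"
  shows "(ln (norm (g w) + C) - ln (norm (g z) + C)) / K \<le> hyp_dist z w"
proof (rule hyp_dist_greatest[OF zw])
  fix \<gamma> L
  assume vp: "valid_path \<gamma>" and img: "path_image \<gamma> \<subseteq> unit_disc"
    and ends: "pathstart \<gamma> = z" "pathfinish \<gamma> = w"
    and L: "((\<lambda>t. norm (vector_derivative \<gamma> (at t within {0..1})) / (1 - (norm (\<gamma> t))\<^sup>2))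
        has_integral L) {0..1}"
  obtain S where S: "finite S" and diff: "\<And>t. t \<in> {0..1} - S \<Longrightarrow> \<gamma> differentiable (at t)"
    and cont: "continuous_on {0..1} \<gamma>"
    using vp unfolding valid_path_def piecewise_C1_differentiable_on_def C1_differentiable_on_eq
    by blast
  have \<gamma>: "\<gamma> t \<in> unit_disc" if "t \<in> {0..1}" for t
    using img that unfolding path_image_def by blast
  define u where "u t = ln (norm (g (\<gamma> t)) + C)" for t
  define v where "v t = vector_derivative \<gamma> (at t)" for t
  \<comment> \<open>The finitely many times at which \<open>\<gamma>\<close> may fail to be differentiable do not affect the integrals;
    both integrands are set to \<open>0\<close> there so that the comparison between them holds everywhere.\<close>
  define u' where "u' t = (if t \<in> S then 0 else
      (sgn (g (\<gamma> t)) \<bullet> (v t * deriv g (\<gamma> t))) / (norm (g (\<gamma> t)) + C))" for t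
  define ell where "ell t = (if t \<in> S then 0 else norm (v t) / (1 - (norm (\<gamma> t))\<^sup>2))" for t
  have "(ell has_integral L) {0..1}"
  proof (rule has_integral_spike_finite[OF S _ L])
    fix t assume t: "t \<in> {0..1} - S"
    have "vector_derivative \<gamma> (at t within {0..1}) = v t"
      unfolding v_def using diff[OF t] t
      by (intro vector_derivative_at_within_ivl) (auto simp: vector_derivative_works[symmetric])
    then show "ell t = norm (vector_derivative \<gamma> (at t within {0..1})) / (1 - (norm (\<gamma> t))\<^sup>2)"
      using t by (simp add: ell_def)
  qed
  then have L': "((\<lambda>t. K * ell t) has_integral K * L) {0..1}"
    by (rule has_integral_mult_right)
  have pos: "norm (g (\<gamma> t)) + C > 0" for t using C by (simp add: add_nonneg_pos)
  have "(u' has_integral (u 1 - u 0)) {0..1}"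
  proof (rule fundamental_theorem_of_calculus_interior_strong[OF S])
    fix t assume t: "t \<in> {0<..<1} - S"
    then have tb: "\<gamma> t \<in> unit_disc" using \<gamma> by auto
    have "(\<gamma> has_vector_derivative v t) (at t)"
      unfolding v_def using diff[of t] t by (simp add: vector_derivative_works[symmetric])
    moreover have "(g has_field_derivative deriv g (\<gamma> t)) (at (\<gamma> t))"
      using hol tb by (intro holomorphic_derivI) auto
    ultimately have "((g \<circ> \<gamma>) has_vector_derivative v t * deriv g (\<gamma> t)) (at t)"
      by (rule field_vector_diff_chain_at)
    then have 1: "((\<lambda>t. g (\<gamma> t)) has_derivative (\<lambda>x. x *\<^sub>R (v t * deriv g (\<gamma> t)))) (at t)"
      by (simp add: has_vector_derivative_def o_def)
    have 2: "(norm has_derivative (\<lambda>h. h \<bullet> sgn (g (\<gamma> t)))) (at (g (\<gamma> t)))"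
      using has_derivative_norm[OF nz[OF tb]] .
    have "((\<lambda>t. norm (g (\<gamma> t))) has_derivative
        (\<lambda>x. (x *\<^sub>R (v t * deriv g (\<gamma> t))) \<bullet> sgn (g (\<gamma> t)))) (at t)"
      using has_derivative_compose[OF 1 2] .
    then have "((\<lambda>t. norm (g (\<gamma> t))) has_real_derivative
        (sgn (g (\<gamma> t)) \<bullet> (v t * deriv g (\<gamma> t)))) (at t)"
      by (rule has_derivative_imp_has_field_derivative) (simp add: inner_commute)
    then have "(u has_real_derivative u' t) (at t)"
      unfolding u_def using t pos[of t] by (auto intro!: derivative_eq_intros simp: u'_def)
    then show "(u has_vector_derivative u' t) (at t)"
      by (simp add: has_real_derivative_iff_has_vector_derivative)
  next
    have "continuous_on {0..1} (\<lambda>t. g (\<gamma> t))"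
      using \<gamma> by (intro continuous_on_compose2[OF holomorphic_on_imp_continuous_on[OF hol] cont]) auto
    then show "continuous_on {0..1} u"
      unfolding u_def using pos by (intro continuous_intros) (auto simp: less_imp_neq[symmetric])
  qed auto
  then have "u 1 - u 0 \<le> K * L"
  proof (rule has_integral_le[OF _ L'])
    fix t :: real assume t: "t \<in> {0..1}"
    show "u' t \<le> K * ell t"
    proof (cases "t \<in> S")
      case False
      have D: "1 - (norm (\<gamma> t))\<^sup>2 > 0"
        using \<gamma>[OF t] by (simp add: abs_square_less_1)
      have "sgn (g (\<gamma> t)) \<bullet> (v t * deriv g (\<gamma> t)) \<le> norm (sgn (g (\<gamma> t))) * norm (v t * deriv g (\<gamma> t))"
        by (rule norm_cauchy_schwarz)
      also have "\<dots> = norm (v t) * norm (deriv g (\<gamma> t))"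
        using nz[OF \<gamma>[OF t]] by (simp add: norm_sgn norm_mult)
      also have "\<dots> \<le> norm (v t) * (K * (norm (g (\<gamma> t)) + C) / (1 - (norm (\<gamma> t))\<^sup>2))"
        using bd[OF \<gamma>[OF t]] D by (intro mult_left_mono) (auto simp: field_simps)
      finally show ?thesis
        using False pos[of t] D by (simp add: u'_def ell_def field_simps)
    qed (simp add: u'_def ell_def)
  qed
  moreover have "u 0 = ln (norm (g z) + C)" "u 1 = ln (norm (g w) + C)"
    using ends by (auto simp: u_def pathstart_def pathfinish_def)
  ultimately show "(ln (norm (g w) + C) - ln (norm (g z) + C)) / K \<le> L"
    using K by (simp add: field_simps)
qed

section \<open>Escape rate of orbits\<close>

lemma iterate_translates:
  assumes "f ` D \<subseteq> D" "\<And>z. z \<in> D \<Longrightarrow> h (f z) = h z + (1::complex)" "z \<in> D"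
  shows "(f ^^ n) z \<in> D" "h ((f ^^ n) z) = h z + of_nat n"
proof (induction n)
  case (Suc n)
  { case 1 show ?case using Suc assms by auto }
  { case 2 show ?case using Suc assms by simp }
qed (use assms in auto)

lemma omitted_translates:
  assumes "(\<lambda>w. w + 1) ` \<Omega> \<subseteq> \<Omega>" "(p::complex) \<notin> \<Omega>"
  shows "p - of_nat k \<notin> \<Omega>"
proof (induction k)
  case (Suc k)
  show ?case
  proof
    assume "p - of_nat (Suc k) \<in> \<Omega>"
    then have "p - of_nat (Suc k) + 1 \<in> \<Omega>" using assms(1) by blast
    with Suc show False by (simp add: algebra_simps)
  qed
qed (use assms in auto)

text \<open>Adding \<open>C\<close> keeps the logarithm finite and bounded below even when \<open>n\<close> is close to \<open>a\<close>, so that the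
  error term is the same for all \<open>n\<close>.\<close>

lemma ln_nat_le_ln_norm_diff:
  fixes a :: complex
  assumes "C > 0" "n \<ge> 1"
  shows "ln (real n) \<le> ln (norm (a - of_nat n) + C) + ln (1 + norm a / C)"
proof -
  have "real n = norm (of_nat n :: complex)" by simp
  also have "\<dots> \<le> norm (a - of_nat n) + norm a"
    by (metis norm_minus_commute norm_triangle_sub add.commute)
  also have "\<dots> \<le> (norm (a - of_nat n) + C) * (1 + norm a / C)"
    using assms by (simp add: field_simps)
  finally have "ln (real n) \<le> ln ((norm (a - of_nat n) + C) * (1 + norm a / C))"
    using assms by (subst ln_le_cancel_iff) (auto intro!: mult_pos_pos add_nonneg_pos add_pos_nonneg)
  also have "\<dots> = ln (norm (a - of_nat n) + C) + ln (1 + norm a / C)"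
    using assms by (intro ln_mult_pos add_nonneg_pos add_pos_nonneg) auto
  finally show ?thesis .
qed

theorem theoremD:
  fixes f h :: "complex \<Rightarrow> complex" and \<Omega> :: "complex set" and z :: complex and \<epsilon> :: real
  assumes "non_elliptic f"
    and "koenigs_pair f \<Omega> h"
    and "\<Omega> \<noteq> UNIV"
    and "z \<in> unit_disc"
    and "\<epsilon> > 0"
  shows "\<exists>c::real. \<forall>n::nat. n \<ge> 1 \<longrightarrow>
    hyp_dist z ((f ^^ n) z) \<ge> 1 / (4 + \<epsilon>) * ln (real n) + c"
proof -
  obtain p where p: "p \<notin> \<Omega>" using assms(3) by blast
  have self: "f ` unit_disc \<subseteq> unit_disc"
    using assms(1) by (simp add: non_elliptic_def)
  have hol: "h holomorphic_on unit_disc" and onto: "h ` unit_disc = \<Omega>"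
    and shift: "\<And>z. z \<in> unit_disc \<Longrightarrow> h (f z) = h z + 1"
    and inv: "(\<lambda>w. w + 1) ` \<Omega> \<subseteq> \<Omega>"
    using assms(2) by (auto simp: koenigs_pair_def asymptotically_starlike_at_infinity_def)
  define g where "g w = p - h w" for w
  have holg: "g holomorphic_on unit_disc"
    unfolding g_def by (intro holomorphic_intros hol)
  have omits: "g w \<noteq> of_nat k" if "w \<in> unit_disc" for w k
  proof
    assume "g w = of_nat k"
    then have "h w = p - of_nat k" by (simp add: g_def algebra_simps)
    moreover have "h w \<in> \<Omega>" using onto that by blast
    ultimately show False using omitted_translates[OF inv p, of k] by simp
  qed
  obtain C where C: "C > 0"
    and bd: "\<And>w. w \<in> unit_disc \<Longrightarrow>
      (1 - (norm w)\<^sup>2) * norm (deriv g w) \<le> (4 + \<epsilon>) * (norm (g w) + C)"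
    using conformal_deriv_bound_omits_nats[of "4 + \<epsilon>"] assms(5) holg omits
    by (metis less_add_same_cancel1)
  define c where "c = - (ln (1 + norm (g z) / C) + ln (norm (g z) + C)) / (4 + \<epsilon>)"
  show ?thesis
  proof (intro exI allI impI)
    fix n :: nat assume n: "n \<ge> 1"
    have it: "(f ^^ n) z \<in> unit_disc" "h ((f ^^ n) z) = h z + of_nat n"
      using iterate_translates[where D = unit_disc and f = f and h = h] self shift assms(4) by blast+
    have gn: "g ((f ^^ n) z) = g z - of_nat n" by (simp add: g_def it(2))
    have "1 / (4 + \<epsilon>) * ln (real n) + c =
        (ln (real n) - ln (1 + norm (g z) / C) - ln (norm (g z) + C)) / (4 + \<epsilon>)"
      by (simp add: c_def diff_divide_distrib add_divide_distrib)
    also have "\<dots> \<le> (ln (norm (g ((f ^^ n) z)) + C) - ln (norm (g z) + C)) / (4 + \<epsilon>)"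
      using ln_nat_le_ln_norm_diff[OF C n, of "g z"] assms(5)
      by (intro divide_right_mono) (auto simp: gn)
    also have "\<dots> \<le> hyp_dist z ((f ^^ n) z)"
      using omits[of _ 0] assms(5) by (intro ln_growth_le_hyp_dist holg C bd assms(4) it(1)) auto
    finally show "hyp_dist z ((f ^^ n) z) \<ge> 1 / (4 + \<epsilon>) * ln (real n) + c" .
  qed
qed

end
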